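(* Let $M=\begin{bmatrix} A_1 & A_2 \\ A_3 & A_4 \end{bmatrix}$ be a $2n\times 2n$ involutory MDS matrix over $\mathbb{F}_{2^r}$, where the $A_i$ are $n\times n$ matrices. Then $M$ can be expressed in the form $M=DHD^{-1}$, where $$H=\begin{bmatrix} A_1 & I_n+A_1 \\ I_n+A_1 & A_1 \end{bmatrix}$$ and $D$ is the block diagonal matrix $\mathrm{diag}(I_n,\,A_3(I_n+A_1)^{-1})$ (the inverses appearing here exist).
   Context: A square matrix $M$ over a field is an MDS matrix if every square submatrix of $M$ (formed by any $i$ rows and any $i$ columns, $i\ge 1$, including $M$ itself) is nonsingular. A matrix $M$ of order $m$ is involutory if $M^2=I_m$. *)

theory Defs
  imports
    "HOL-Library.Cardinality"
    "Jordan_Normal_Form.Gauss_Jordan_Elimination"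
    "Jordan_Normal_Form.DL_Submatrix"
begin

(* Rows and columns are indexed from 0. The index sets are restricted to actual
   indices of M, so that submatrix M I J has order card I = card J. *)
definition mds_mat :: "'a::field mat \<Rightarrow> bool" where
  "mds_mat M \<longleftrightarrow> square_mat M \<and>
     (\<forall>I J. I \<subseteq> {..<dim_row M} \<longrightarrow> J \<subseteq> {..<dim_col M} \<longrightarrow>
        card I = card J \<longrightarrow> card I \<ge> 1 \<longrightarrow> invertible_mat (submatrix M I J))"

definition involutory_mat :: "'a::semiring_1 mat \<Rightarrow> bool" where
  "involutory_mat M \<longleftrightarrow> square_mat M \<and> M * M = 1\<^sub>m (dim_row M)"

(* mat_inverse returns None on singular matrices, so mat_inv A is meaningful only
   together with invertible_mat A. *)
abbreviation mat_inv :: "'a::field mat \<Rightarrow> 'a mat" where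
  "mat_inv A \<equiv> the (mat_inverse A)"

end

theory Submission
  imports Defs "Jordan_Normal_Form.Determinant"
begin

text \<open>
  In characteristic 2 the blocks of \<open>M * M = 1\<close> give \<open>A2 * A3 = 1 + A1 * A1 = (1 + A1)\<^sup>2\<close> and
  \<open>A4 * A3 = A3 * A1\<close>. Both \<open>A2\<close> and \<open>A3\<close> are submatrices of the MDS matrix \<open>M\<close>, so \<open>1 + A1\<close> is
  invertible, and it commutes with \<open>A1\<close>. A block computation then yields \<open>M * D = D * H\<close>.
\<close>

text \<open>Translation by 1 permutes the field, so the sum of all elements absorbs
  \<open>CARD('a)\<close> copies of 1. Hence \<open>2 ^ r = 0\<close> in the field, and a power
  vanishes only if its base does.\<close>

lemma two_eq_zero_if_card_pow_two:
  assumes "CARD('a::{field,finite}) = 2 ^ r"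
  shows "(1 :: 'a) + 1 = 0"
proof -
  have "(\<Sum>x\<in>UNIV. x) = (\<Sum>x\<in>UNIV. x + (1 :: 'a))"
    by (rule sum.reindex_bij_witness[of _ "\<lambda>x. x + 1" "\<lambda>x. x - 1"]) auto
  then have "of_nat CARD('a) = (0 :: 'a)"
    by (simp add: sum.distrib)
  then have "(2 :: 'a) ^ r = 0"
    using assms by simp
  then show ?thesis
    by simp
qed

lemma invertible_matI:
  fixes A :: "'a::field mat"
  assumes "A \<in> carrier_mat n n" "B \<in> carrier_mat n n" "A * B = 1\<^sub>m n"
  shows "invertible_mat A"
  using assms mat_mult_left_right_inverse[OF assms]
  unfolding invertible_mat_def inverts_mat_def by auto

text \<open>\<open>invertible_mat\<close> leaves the shape of the inverse open; comparing dimensions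
  in the two product equations forces it to be \<open>n\<close> by \<open>n\<close>.\<close>

lemma invertible_matE:
  fixes A :: "'a::field mat"
  assumes A: "A \<in> carrier_mat n n" and "invertible_mat A"
  obtains B where "B \<in> carrier_mat n n" "A * B = 1\<^sub>m n" "B * A = 1\<^sub>m n"
proof -
  obtain B where AB: "A * B = 1\<^sub>m n" and BA: "B * A = 1\<^sub>m (dim_row B)"
    using assms unfolding invertible_mat_def inverts_mat_def by auto
  have "dim_col B = n"
    using arg_cong[OF AB, of dim_col] by simp
  moreover have "dim_row B = n"
    using arg_cong[OF BA, of dim_col] A by simp
  ultimately show ?thesis
    using that AB BA by (metis carrier_matI)
qed

text \<open>An invertible matrix is a unit of the matrix ring, which rules out the value
  \<open>None\<close> of \<open>mat_inverse\<close>, so \<open>the\<close> is applied to a genuine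
  inverse.\<close>

lemma mat_inv:
  fixes A :: "'a::field mat"
  assumes A: "A \<in> carrier_mat n n" and inv: "invertible_mat A"
  shows "A * mat_inv A = 1\<^sub>m n" "mat_inv A * A = 1\<^sub>m n" "mat_inv A \<in> carrier_mat n n"
proof -
  have "A \<in> Units (ring_mat TYPE('a) n ())"
    using invertible_matE[OF A inv] A unfolding Units_def by (auto simp: ring_mat_simps)
  then obtain B where "mat_inverse A = Some B"
    using mat_inverse(1)[OF A, of "()"] by (cases "mat_inverse A") auto
  then show "A * mat_inv A = 1\<^sub>m n" "mat_inv A * A = 1\<^sub>m n" "mat_inv A \<in> carrier_mat n n"
    using mat_inverse(2)[OF A] by auto
qed

lemma invertible_mat_mult:
  fixes A B :: "'a::field mat"
  assumes A: "A \<in> carrier_mat n n" and B: "B \<in> carrier_mat n n"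
    and "invertible_mat A" "invertible_mat B"
  shows "invertible_mat (A * B)"
proof -
  note a = mat_inv[OF A \<open>invertible_mat A\<close>] and b = mat_inv[OF B \<open>invertible_mat B\<close>]
  have "(A * B) * (mat_inv B * mat_inv A) = A * (B * mat_inv B) * mat_inv A"
    using A B a(3) b(3) by (simp add: assoc_mult_mat[of _ n n _ n _ n])
  also have "\<dots> = 1\<^sub>m n"
    using A a b by simp
  finally show ?thesis
    using A B a(3) b(3) by (intro invertible_matI[of _ n "mat_inv B * mat_inv A"]) auto
qed

text \<open>Reassociating turns \<open>B * mat_inv (A * B)\<close> into a right inverse of
  \<open>A\<close>. With equal factors this passes from an invertible square to its root.\<close>

lemma invertible_mat_mult_leftD:
  fixes A B :: "'a::field mat"
  assumes A: "A \<in> carrier_mat n n" and B: "B \<in> carrier_mat n n" and "invertible_mat (A * B)"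
  shows "invertible_mat A"
proof -
  have "A * B \<in> carrier_mat n n"
    using A B by simp
  note ab = mat_inv[OF this assms(3)]
  have "A * (B * mat_inv (A * B)) = 1\<^sub>m n"
    using assoc_mult_mat[OF A B ab(3)] ab(1) by simp
  then show ?thesis
    using A B ab(3) by (intro invertible_matI[of _ n "B * mat_inv (A * B)"]) auto
qed

text \<open>The empty matrix is its own inverse. This covers \<open>n = 0\<close>, about which
  \<open>mds_mat\<close> is silent because it speaks of orders at least 1.\<close>

lemma invertible_mat_zero_dim: "A \<in> carrier_mat 0 0 \<Longrightarrow> invertible_mat (A :: 'a::field mat)"
  by (rule invertible_matI[of _ 0 A]) auto

lemma invertible_four_block_diag:
  fixes A B :: "'a::field mat"
  assumes A: "A \<in> carrier_mat m m" and B: "B \<in> carrier_mat n n"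
    and "invertible_mat A" "invertible_mat B"
  shows "invertible_mat (four_block_mat A (0\<^sub>m m n) (0\<^sub>m n m) B)"
proof -
  note a = mat_inv[OF A \<open>invertible_mat A\<close>] and b = mat_inv[OF B \<open>invertible_mat B\<close>]
  have "four_block_mat A (0\<^sub>m m n) (0\<^sub>m n m) B *
      four_block_mat (mat_inv A) (0\<^sub>m m n) (0\<^sub>m n m) (mat_inv B) = 1\<^sub>m (m + n)"
    using A B a b by (subst mult_four_block_mat) auto
  then show ?thesis
    using A B a(3) b(3) by (intro invertible_matI[where n = "m + n"]) auto
qed

text \<open>Exactly \<open>i\<close> elements of the interval lie below \<open>m + i\<close>, and
  \<open>pick\<close> counts from 0.\<close>

lemma pick_atLeastLessThan:
  assumes "i < k"
  shows "pick {m..<m + k} i = m + i"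
proof -
  have "{a \<in> {m..<m + k}. a < m + i} = {m..<m + i}"
    using assms by auto
  then show ?thesis
    using pick_card_in_set[of "m + i" "{m..<m + k}"] assms by simp
qed

lemma submatrix_atLeastLessThan:
  assumes "r + p \<le> dim_row A" "c + q \<le> dim_col A"
  shows "submatrix A {r..<r + p} {c..<c + q} = mat p q (\<lambda>(i, j). A $$ (r + i, c + j))"
proof -
  have "{i. i < dim_row A \<and> i \<in> {r..<r + p}} = {r..<r + p}"
    "{j. j < dim_col A \<and> j \<in> {c..<c + q}} = {c..<c + q}"
    using assms by auto
  then show ?thesis
    unfolding submatrix_def by (intro eq_matI) (auto simp: pick_atLeastLessThan)
qed

lemma mds_mat_contiguous_submatrix:
  assumes "mds_mat M" "r + n \<le> dim_row M" "c + n \<le> dim_col M"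
  shows "invertible_mat (mat n n (\<lambda>(i, j). M $$ (r + i, c + j)))"
proof (cases "n = 0")
  case True
  then show ?thesis
    by (intro invertible_mat_zero_dim) simp
next
  case False
  have "{r..<r + n} \<subseteq> {..<dim_row M}" "{c..<c + n} \<subseteq> {..<dim_col M}"
    using assms by auto
  then have "invertible_mat (submatrix M {r..<r + n} {c..<c + n})"
    using assms(1) False unfolding mds_mat_def by simp
  then show ?thesis
    using assms by (simp add: submatrix_atLeastLessThan)
qed

lemma mds_mat_off_diagonal_blocks:
  assumes "A1 \<in> carrier_mat n n" "A2 \<in> carrier_mat n n"
    and "A3 \<in> carrier_mat n n" "A4 \<in> carrier_mat n n"
    and "mds_mat (four_block_mat A1 A2 A3 A4)"
  shows "invertible_mat A2" "invertible_mat A3"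
proof -
  let ?M = "four_block_mat A1 A2 A3 A4"
  \<comment> \<open>The off-diagonal blocks are the windows with offsets \<open>(0, n)\<close> and
    \<open>(n, 0)\<close>.\<close>
  have "mat n n (\<lambda>(i, j). ?M $$ (0 + i, n + j)) = A2" "mat n n (\<lambda>(i, j). ?M $$ (n + i, 0 + j)) = A3"
    using assms(1-4) by auto
  then show "invertible_mat A2" "invertible_mat A3"
    using mds_mat_contiguous_submatrix[OF assms(5), of 0 n n]
      mds_mat_contiguous_submatrix[OF assms(5), of n n 0] assms(1-4) by simp_all
qed

text \<open>Corresponding blocks have the same shape, so they occupy the same windows, with offsets
  \<open>(0, 0)\<close>, \<open>(0, q)\<close>, \<open>(p, 0)\<close> and
  \<open>(p, q)\<close>.\<close>

lemma four_block_mat_inj: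
  assumes "four_block_mat A B C D = four_block_mat A' B' C' D'"
    and "A \<in> carrier_mat p q" "B \<in> carrier_mat p s" "C \<in> carrier_mat r q" "D \<in> carrier_mat r s"
    and "A' \<in> carrier_mat p q" "B' \<in> carrier_mat p s" "C' \<in> carrier_mat r q" "D' \<in> carrier_mat r s"
  shows "A = A'" "B = B'" "C = C'" "D = D'"
proof -
  have *: "four_block_mat A B C D $$ (i, j) = four_block_mat A' B' C' D' $$ (i, j)" for i j
    using assms(1) by simp
  show "A = A'"
  proof (rule eq_matI)
    fix i j assume "i < dim_row A'" "j < dim_col A'"
    then show "A $$ (i, j) = A' $$ (i, j)" using *[of i j] assms(2-) by simp
  qed (use assms(2-) in auto)
  show "B = B'"
  proof (rule eq_matI)
    fix i j assume "i < dim_row B'" "j < dim_col B'"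
    then show "B $$ (i, j) = B' $$ (i, j)" using *[of i "q + j"] assms(2-) by simp
  qed (use assms(2-) in auto)
  show "C = C'"
  proof (rule eq_matI)
    fix i j assume "i < dim_row C'" "j < dim_col C'"
    then show "C $$ (i, j) = C' $$ (i, j)" using *[of "p + i" j] assms(2-) by simp
  qed (use assms(2-) in auto)
  show "D = D'"
  proof (rule eq_matI)
    fix i j assume "i < dim_row D'" "j < dim_col D'"
    then show "D $$ (i, j) = D' $$ (i, j)" using *[of "p + i" "q + j"] assms(2-) by simp
  qed (use assms(2-) in auto)
qed

lemma mat_add_self_char_two:
  fixes A :: "'a::field mat"
  assumes "(1 :: 'a) + 1 = 0" "A \<in> carrier_mat m n"
  shows "A + A = 0\<^sub>m m n"
proof -
  have "x + x = 0" for x :: 'a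
    using assms(1) by (metis distrib_left mult.right_neutral mult_zero_right)
  then show ?thesis
    using assms(2) by (intro eq_matI) auto
qed

text \<open>Adding \<open>A\<close> again cancels it, so a summand changes sides without a
  sign.\<close>

lemma mat_add_eq_imp_eq_add_char_two:
  fixes A B C :: "'a::field mat"
  assumes two: "(1 :: 'a) + 1 = 0" and A: "A \<in> carrier_mat m n" and B: "B \<in> carrier_mat m n"
    and "A + B = C"
  shows "B = A + C"
proof -
  have "A + C = A + A + B"
    using A B assms(4) by (metis assoc_add_mat)
  then show ?thesis
    using mat_add_self_char_two[OF two A] B by simp
qed

text \<open>Multiply \<open>A * B = B * A\<close> by the inverse of \<open>B\<close> on both
  sides.\<close>

lemma mat_inv_commute:
  fixes A B :: "'a::field mat"
  assumes A: "A \<in> carrier_mat n n" and B: "B \<in> carrier_mat n n"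
    and inv: "invertible_mat B" and comm: "A * B = B * A"
  shows "A * mat_inv B = mat_inv B * A"
proof -
  note b = mat_inv[OF B inv] and assoc = assoc_mult_mat[of _ n n _ n _ n]
  have "A * mat_inv B = (mat_inv B * B) * A * mat_inv B"
    using A b by simp
  also have "\<dots> = mat_inv B * (A * B) * mat_inv B"
    using A B b(3) unfolding comm by (simp add: assoc)
  also have "\<dots> = mat_inv B * A"
    using A B b by (simp add: assoc)
  finally show ?thesis .
qed

theorem lemma5:
  fixes M A1 A2 A3 A4 :: "'a::{field,finite} mat" and n r :: nat
  assumes "CARD('a) = 2 ^ r"
    and "A1 \<in> carrier_mat n n" "A2 \<in> carrier_mat n n"
    and "A3 \<in> carrier_mat n n" "A4 \<in> carrier_mat n n"
    and "M = four_block_mat A1 A2 A3 A4"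
    and "involutory_mat M" and "mds_mat M"
  shows "invertible_mat (1\<^sub>m n + A1) \<and>
    (let H = four_block_mat A1 (1\<^sub>m n + A1) (1\<^sub>m n + A1) A1;
         D = four_block_mat (1\<^sub>m n) (0\<^sub>m n n) (0\<^sub>m n n) (A3 * mat_inv (1\<^sub>m n + A1))
     in invertible_mat D \<and> M = D * H * mat_inv D)"
proof -
  note A = assms(2-5) and M = assms(6) and assoc = assoc_mult_mat[of _ n n _ n _ n]
  note two = two_eq_zero_if_card_pow_two[OF assms(1)]
  define B where "B = 1\<^sub>m n + A1"
  define P where "P = A3 * mat_inv B"
  define H where "H = four_block_mat A1 B B A1"
  define D where "D = four_block_mat (1\<^sub>m n) (0\<^sub>m n n) (0\<^sub>m n n) P"
  have B: "B \<in> carrier_mat n n"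
    using A by (simp add: B_def)
  have inv23: "invertible_mat A2" "invertible_mat A3"
    using mds_mat_off_diagonal_blocks[OF A] assms(8) unfolding M by auto

  \<comment> \<open>The identity is split into blocks of order \<open>n\<close> so that the left
    block column of \<open>M * M\<close> can be read off.\<close>
  have "M * M = four_block_mat (1\<^sub>m n) (0\<^sub>m n n) (0\<^sub>m n n) (1\<^sub>m n)"
    using assms(7) A unfolding involutory_mat_def M by simp
  then have blocks: "four_block_mat (A1 * A1 + A2 * A3) (A1 * A2 + A2 * A4)
      (A3 * A1 + A4 * A3) (A3 * A2 + A4 * A4) =
      four_block_mat (1\<^sub>m n) (0\<^sub>m n n) (0\<^sub>m n n) (1\<^sub>m n)"
    unfolding M using mult_four_block_mat[OF A A] by simp
  have sq: "A1 * A1 + A2 * A3 = 1\<^sub>m n"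
    by (rule four_block_mat_inj(1)[OF blocks, of n n n n]) (use A in auto)
  have off: "A3 * A1 + A4 * A3 = 0\<^sub>m n n"
    by (rule four_block_mat_inj(3)[OF blocks, of n n n n]) (use A in auto)

  have "A2 * A3 = A1 * A1 + 1\<^sub>m n"
    by (rule mat_add_eq_imp_eq_add_char_two[OF two _ _ sq]) (use A in auto)
  moreover have "B * B = 1\<^sub>m n + (A1 + A1) + A1 * A1"
    using A unfolding B_def
    by (simp add: add_mult_distrib_mat[of _ n n _ _ n] mult_add_distrib_mat[of _ n n _ n]
        assoc_add_mat[of _ n n])
  \<comment> \<open>The cross terms \<open>A1 + A1\<close> vanish in characteristic 2.\<close>
  ultimately have BB: "B * B = A2 * A3"
    using A mat_add_self_char_two[OF two A(1)] comm_add_mat[of "1\<^sub>m n" n n "A1 * A1"] by simp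
  have A43: "A4 * A3 = A3 * A1"
    using mat_add_eq_imp_eq_add_char_two[OF two, of _ n n, OF _ _ off] A by simp

  \<comment> \<open>\<open>B * B\<close> is a product of two invertible blocks, and \<open>B\<close>
    is its left factor.\<close>
  have invB: "invertible_mat B"
    using invertible_mat_mult_leftD[OF B B] invertible_mat_mult[OF A(2,3) inv23] BB by simp
  note b = mat_inv[OF B invB]
  have "A1 * B = B * A1"
    using A unfolding B_def
    by (simp add: add_mult_distrib_mat[of _ n n _ _ n] mult_add_distrib_mat[of _ n n _ n])
  then have A1Bi: "A1 * mat_inv B = mat_inv B * A1"
    by (rule mat_inv_commute[OF A(1) B invB])

  have P: "P \<in> carrier_mat n n"
    using A b(3) by (simp add: P_def)
  have "invertible_mat (mat_inv B)"
    by (rule invertible_matI[OF b(3) B b(2)])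
  then have "invertible_mat P"
    unfolding P_def using invertible_mat_mult[OF A(3) b(3)] inv23 by simp
  moreover have "invertible_mat (1\<^sub>m n :: 'a mat)"
    by (rule invertible_matI[of _ n "1\<^sub>m n"]) auto
  ultimately have invD: "invertible_mat D"
    unfolding D_def using P by (intro invertible_four_block_diag) auto
  have D: "D \<in> carrier_mat (n + n) (n + n)"
    using P by (simp add: D_def)
  note d = mat_inv[OF D invD]

  \<comment> \<open>\<open>A2P\<close>, \<open>PB\<close> and \<open>A4P\<close> match
    \<open>M * D\<close> with \<open>D * H\<close> in the upper right, lower left and lower right
    blocks; the upper left block is \<open>A1\<close> in both.\<close>
  have A2P: "A2 * P = B"
  proof -
    have "A2 * P = A2 * A3 * mat_inv B"
      using A b(3) by (simp add: P_def assoc)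
    also have "\<dots> = B * (B * mat_inv B)"
      using B b(3) by (simp add: BB[symmetric] assoc)
    finally show ?thesis
      using B b by simp
  qed
  have PB: "P * B = A3"
    using A B b by (simp add: P_def assoc)
  have A4P: "A4 * P = P * A1"
  proof -
    have "A4 * P = A4 * A3 * mat_inv B"
      using A b(3) by (simp add: P_def assoc)
    \<comment> \<open>\<open>A43\<close> trades \<open>A4\<close> for \<open>A1\<close> across
      \<open>A3\<close>; then \<open>A1\<close> moves past the inverse of \<open>B\<close>.\<close>
    also have "\<dots> = A3 * (A1 * mat_inv B)"
      using A b(3) by (simp add: A43 assoc)
    finally show ?thesis
      using A b(3) by (simp add: A1Bi P_def assoc)
  qed

  have "M * D = four_block_mat A1 B A3 (P * A1)"
    unfolding M D_def using A B P by (subst mult_four_block_mat) (auto simp: A2P A4P)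
  moreover have "D * H = four_block_mat A1 B A3 (P * A1)"
    unfolding H_def D_def using A B P by (subst mult_four_block_mat) (auto simp: PB)
  \<comment> \<open>Both products have the same blocks, so \<open>M * D = D * H\<close>, and
    cancelling \<open>D\<close> on the right gives the factorization.\<close>
  ultimately have "D * H * mat_inv D = M * D * mat_inv D"
    by simp
  also have "\<dots> = M"
    using A D d unfolding M by (simp add: assoc_mult_mat[of _ "n + n" "n + n" _ "n + n" _ "n + n"])
  finally show ?thesis
    using invB invD unfolding Let_def B_def[symmetric] P_def[symmetric] H_def[symmetric] D_def[symmetric]
    by simp
qed

end
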